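(* Let $D\in\{\mathbb{B}^n,\mathbb{H}^n\}$. For any $x\in D$ and $r\in(0,1)$, $$B_\rho(x,R_1)\subset B_{\tilde c}(x,r)\subset B_\rho(x,R_2),$$ where $R_1=\log(1+r)$ and $R_2=2\log\left(1+\frac{r}{1-r}\right)$. Moreover, $R_2/R_1\to 2$ as $r\to 0$.
   Context: $\mathbb{B}^n=\{z\in\mathbb{R}^n:|z|<1\}$ and $\mathbb{H}^n=\{(x_1,\dots,x_n)\in\mathbb{R}^n:x_n>0\}$. The hyperbolic metric $\rho_D$ is given by $\sinh\frac{\rho_{\mathbb{B}^n}(x,y)}{2}=\frac{|x-y|}{\sqrt{(1-|x|^2)(1-|y|^2)}}$ for $x,y\in\mathbb{B}^n$ and $\cosh\rho_{\mathbb{H}^n}(x,y)=1+\frac{|x-y|^2}{2x_ny_n}$ for $x,y\in\mathbb{H}^n$. For $x,y\in D$, $\tilde c_D(x,y)=\sup_{p\in\partial D}\frac{|x-y|}{\max\{|x-p|,|y-p|\}}$, where $\partial D$ is the boundary in $\mathbb{R}^n$. Metric balls: $B_{\tilde c}(x,r)=\{y\in D:\tilde c_D(x,y)<r\}$ and $B_\rho(x,R)=\{y\in D:\rho_D(x,y)<R\}$. *)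

theory Defs
  imports "HOL-Analysis.Analysis"
begin

text \<open>
  Euclidean space of dimension \<open>n \<ge> 1\<close> is \<open>real ^ 'n\<close> with a finite, linearly ordered index
  type; \<open>Max UNIV\<close> is its last index, so \<open>last_coord x\<close> is the coordinate usually
  written \<open>x\<^sub>n\<close>. The unit ball is the library's \<open>ball 0 1\<close>.
\<close>

definition last_coord :: "real ^ 'n::{finite,linorder} \<Rightarrow> real" where
  "last_coord x = x $ Max UNIV"

definition upper_half_space :: "(real ^ 'n::{finite,linorder}) set" where
  "upper_half_space = {x. last_coord x > 0}"

definition hyp_dist_ball :: "real ^ 'n \<Rightarrow> real ^ 'n \<Rightarrow> real" where
  "hyp_dist_ball x y =
     2 * arsinh (norm (x - y) / sqrt ((1 - (norm x)\<^sup>2) * (1 - (norm y)\<^sup>2)))"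

definition hyp_dist_half :: "real ^ 'n::{finite,linorder} \<Rightarrow> real ^ 'n::{finite,linorder} \<Rightarrow> real" where
  "hyp_dist_half x y = arcosh (1 + (norm (x - y))\<^sup>2 / (2 * last_coord x * last_coord y))"

text \<open>The usual implicit formulas; together with nonnegativity they determine the metrics.\<close>

lemma sinh_hyp_dist_ball:
  "sinh (hyp_dist_ball x y / 2) =
     norm (x - y) / sqrt ((1 - (norm x)\<^sup>2) * (1 - (norm y)\<^sup>2))"
  by (simp add: hyp_dist_ball_def)

lemma cosh_hyp_dist_half:
  assumes "x \<in> upper_half_space" "y \<in> upper_half_space"
  shows "cosh (hyp_dist_half x y) =
     1 + (norm (x - y))\<^sup>2 / (2 * last_coord x * last_coord y)"
    and "hyp_dist_half x y \<ge> 0"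
  using assms by (simp_all add: hyp_dist_half_def upper_half_space_def)

text \<open>
  The supremum is a genuine one whenever \<open>x, y \<in> D\<close> and \<open>D\<close> is open, nonempty and not the
  whole space: the boundary is then nonempty, and every quotient is at most \<open>2\<close> by the
  triangle inequality, with positive denominator.
\<close>

definition c_tilde :: "'a::real_normed_vector set \<Rightarrow> 'a \<Rightarrow> 'a \<Rightarrow> real" where
  "c_tilde D x y = (SUP p\<in>frontier D. norm (x - y) / max (norm (x - p)) (norm (y - p)))"

definition dist_ball :: "'a set \<Rightarrow> ('a \<Rightarrow> 'a \<Rightarrow> real) \<Rightarrow> 'a \<Rightarrow> real \<Rightarrow> 'a set" where
  "dist_ball D d x r = {y \<in> D. d x y < r}"

end

theory Submission
  imports Defs "HOL-Real_Asymp.Real_Asymp"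
begin

text \<open>
  Write \<open>\<delta>\<close> for the distance to the boundary. Since \<open>\<bar>x - p\<bar> \<ge> \<delta> x\<close> for every boundary point \<open>p\<close>,
  a bound \<open>\<bar>x - y\<bar> \<le> q * max (\<delta> x) (\<delta> y)\<close> gives \<open>c_tilde x y \<le> q\<close>, and the explicit formulas for
  the hyperbolic metrics give such a bound with \<open>q = r / sqrt (1 + r)\<close> when \<open>\<rho> x y < ln (1 + r)\<close>.
  Conversely, testing the supremum at a boundary point nearest to \<open>x\<close> shows that
  \<open>c_tilde x y < r\<close> implies \<open>\<bar>x - y\<bar> < r / (1 - r) * \<delta> x\<close>; the same holds for \<open>y\<close>, and the
  inequality \<open>\<rho> \<le> 2 j\<close> with the distance ratio metric
  \<open>j x y = ln (1 + \<bar>x - y\<bar> / min (\<delta> x) (\<delta> y))\<close> finishes the proof.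
\<close>

section \<open>Bounds for the supremum over the boundary of a general set\<close>

lemma c_tilde_commute: "c_tilde D x y = c_tilde D y x"
  by (simp add: c_tilde_def norm_minus_commute max.commute)

text \<open>The bound is assumed in product form, so it also makes sense when
  \<open>x = p = y\<close>; there the quotient is 0 because division by zero gives 0.\<close>

lemma c_tilde_le:
  assumes "frontier D \<noteq> {}" and "0 \<le> q"
    and "\<And>p. p \<in> frontier D \<Longrightarrow> norm (x - y) \<le> q * max (norm (x - p)) (norm (y - p))"
  shows "c_tilde D x y \<le> q"
  unfolding c_tilde_def
proof (rule cSUP_least)
  fix p assume "p \<in> frontier D"
  then have *: "norm (x - y) \<le> q * max (norm (x - p)) (norm (y - p))"
    by (rule assms(3))
  show "norm (x - y) / max (norm (x - p)) (norm (y - p)) \<le> q"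
  proof (cases "max (norm (x - p)) (norm (y - p)) = 0")
    case True
    then show ?thesis using assms(2) by simp
  next
    case False
    then have "max (norm (x - p)) (norm (y - p)) > 0"
      by (metis norm_ge_zero less_eq_real_def max.coboundedI1)
    then show ?thesis using * by (simp add: pos_divide_le_eq)
  qed
qed (rule assms(1))

text \<open>A real supremum dominates its members once the family is bounded above; the triangle
  inequality through \<open>q\<close> bounds every quotient by 2.\<close>

lemma c_tilde_ge:
  assumes "p \<in> frontier D"
  shows "norm (x - y) / max (norm (x - p)) (norm (y - p)) \<le> c_tilde D x y"
proof -
  have "norm (x - y) / max (norm (x - q)) (norm (y - q)) \<le> 2" for q
  proof -
    have "norm (x - y) \<le> norm (x - q) + norm (y - q)"
      using norm_triangle_ineq4[of "x - q" "y - q"] by simp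
    then have *: "norm (x - y) \<le> 2 * max (norm (x - q)) (norm (y - q))"
      by linarith
    show ?thesis
    proof (cases "max (norm (x - q)) (norm (y - q)) = 0")
      case False
      then have "max (norm (x - q)) (norm (y - q)) > 0"
        by (metis norm_ge_zero less_eq_real_def max.coboundedI1)
      then show ?thesis using * by (simp add: pos_divide_le_eq)
    qed simp
  qed
  then have "bdd_above ((\<lambda>q. norm (x - y) / max (norm (x - q)) (norm (y - q))) ` frontier D)"
    by (intro bdd_aboveI2)
  then show ?thesis
    unfolding c_tilde_def using assms by (intro cSUP_upper)
qed

text \<open>Since |y - p| <= |x - p| + |x - y|, the maximum in the quotient is at most |x - p| + |x
  - y|. Solving |x - y| < r (|x - p| + |x - y|) for |x - y| produces the factor r / (1 - r).\<close>

lemma norm_diff_less_of_c_tilde_less: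
  assumes "p \<in> frontier D" and "x \<noteq> p" and "0 < r" "r < 1" and "c_tilde D x y < r"
  shows "norm (x - y) / norm (x - p) < r / (1 - r)"
proof -
  have pos: "norm (x - p) > 0" using assms(2) by simp
  then have "max (norm (x - p)) (norm (y - p)) > 0" by linarith
  moreover have "norm (x - y) / max (norm (x - p)) (norm (y - p)) < r"
    using c_tilde_ge[OF assms(1)] assms(5) by (rule le_less_trans)
  ultimately have "norm (x - y) < r * max (norm (x - p)) (norm (y - p))"
    by (simp add: pos_divide_less_eq)
  also have "\<dots> \<le> r * (norm (x - p) + norm (x - y))"
    using assms(3) norm_triangle_ineq[of "y - x" "x - p"]
    by (intro mult_left_mono) (auto simp: norm_minus_commute)
  finally show ?thesis
    using assms(3,4) pos by (simp add: field_simps)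
qed

section \<open>Boundary of the half space and symmetry of the metrics\<close>

lemma last_coord_inner: "last_coord x = axis (Max UNIV) 1 \<bullet> x"
  by (simp add: last_coord_def inner_axis')

lemma frontier_upper_half_space:
  "frontier (upper_half_space :: (real ^ 'n::{finite,linorder}) set) = {x. last_coord x = 0}"
proof -
  have "axis (Max UNIV) 1 \<noteq> (0 :: real ^ 'n::{finite,linorder})" by (simp add: axis_eq_0_iff)
  then show ?thesis
    unfolding upper_half_space_def last_coord_inner
    using frontier_halfspace_gt[of "axis (Max UNIV) 1 :: real ^ 'n::{finite,linorder}" 0] by simp
qed

lemma last_coord_le_norm_diff:
  assumes "last_coord p = 0"
  shows "last_coord x \<le> norm (x - p)"
  using component_le_norm_cart[of "x - p" "Max UNIV"] assms by (simp add: last_coord_def)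

lemma hyp_dist_ball_commute: "hyp_dist_ball x y = hyp_dist_ball y x"
  by (simp add: hyp_dist_ball_def norm_minus_commute mult.commute)

lemma hyp_dist_half_commute: "hyp_dist_half x y = hyp_dist_half y x"
  by (simp add: hyp_dist_half_def norm_minus_commute mult.commute mult.left_commute)

section \<open>From a small hyperbolic distance to a bound by boundary distances\<close>

lemma norm_diff_le_of_sq_less:
  fixes t r a b M :: real
  assumes "0 < r" and "t\<^sup>2 * (1 + r) \<le> r\<^sup>2 * (a * b)" and "0 \<le> a" "0 \<le> b" and "a \<le> M" "b \<le> M"
  shows "t \<le> r / sqrt (1 + r) * M"
proof -
  have "a * b \<le> M * M" using assms by (intro mult_mono) auto
  then have "r\<^sup>2 * (a * b) \<le> r\<^sup>2 * M\<^sup>2"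
    by (intro mult_left_mono) (auto simp: power2_eq_square)
  then have "t\<^sup>2 * (1 + r) \<le> r\<^sup>2 * M\<^sup>2" using assms(2) by linarith
  then have "(t * sqrt (1 + r))\<^sup>2 \<le> (r * M)\<^sup>2" using assms(1) by (simp add: power_mult_distrib)
  moreover have "0 \<le> r * M" using assms by simp
  ultimately have "t * sqrt (1 + r) \<le> r * M" by (rule power2_le_imp_le)
  then show ?thesis using assms(1) by (simp add: field_simps)
qed

lemma hyp_dist_half_less_imp:
  assumes "x \<in> upper_half_space" "y \<in> upper_half_space" and "0 < r"
    and "hyp_dist_half x y < ln (1 + r)"
  shows "(norm (x - y))\<^sup>2 * (1 + r) \<le> r\<^sup>2 * (last_coord x * last_coord y)"
proof -
  have pos: "last_coord x > 0" "last_coord y > 0"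
    using assms by (auto simp: upper_half_space_def)
  have "cosh (hyp_dist_half x y) < cosh (ln (1 + r))"
    using assms cosh_hyp_dist_half(2)[of x y] by (intro cosh_real_strict_mono) auto
  \<comment> \<open>This uses cosh (ln (1 + r)) - 1 = r^2 / (2 (1 + r)).\<close>
  then have "(norm (x - y))\<^sup>2 / (2 * last_coord x * last_coord y) < r\<^sup>2 / (2 * (1 + r))"
    using assms by (simp add: cosh_hyp_dist_half cosh_ln_real field_simps power2_eq_square)
  then show ?thesis
    using pos assms(3) by (simp add: field_simps)
qed

text \<open>The formula for the ball involves half the distance, and sinh (ln (1 + r) / 2) = r / (2
  sqrt (1 + r)). Squaring leaves a factor 4, which is absorbed by 1 - u^2 <= 2 (1 - u) at both
  points, so the result has the same shape as for the half space.\<close>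

lemma hyp_dist_ball_less_imp:
  assumes "norm x < 1" "norm y < 1" and "0 < r" and "hyp_dist_ball x y < ln (1 + r)"
  shows "(norm (x - y))\<^sup>2 * (1 + r) \<le> r\<^sup>2 * ((1 - norm x) * (1 - norm y))"
proof -
  define A where "A = (1 - (norm x)\<^sup>2) * (1 - (norm y)\<^sup>2)"
  have A: "A > 0"
    unfolding A_def using assms by (intro mult_pos_pos) (simp_all add: power_less_one_iff)
  have "sinh (hyp_dist_ball x y / 2) < sinh (ln (1 + r) / 2)"
    using assms by simp
  also have "ln (1 + r) / 2 = ln (sqrt (1 + r))"
    using assms by (simp add: ln_sqrt)
  finally have "norm (x - y) / sqrt A < (sqrt (1 + r) - inverse (sqrt (1 + r))) / 2"
    using assms by (simp add: sinh_hyp_dist_ball sinh_ln_real A_def)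
  also have "\<dots> = r / (2 * sqrt (1 + r))"
    using assms by (simp add: field_simps)
  finally have "norm (x - y) * (2 * sqrt (1 + r)) \<le> r * sqrt A"
    using A assms by (simp add: field_simps)
  then have "(norm (x - y) * (2 * sqrt (1 + r)))\<^sup>2 \<le> (r * sqrt A)\<^sup>2"
    using assms by (intro power_mono) auto
  then have "4 * ((norm (x - y))\<^sup>2 * (1 + r)) \<le> r\<^sup>2 * A"
    using A assms by (simp add: power_mult_distrib mult_ac)
  also have "A \<le> (2 * (1 - norm x)) * (2 * (1 - norm y))"
  proof -
    have le: "1 - u\<^sup>2 \<le> 2 * (1 - u)" for u :: real
      using zero_le_power2[of "1 - u"] by (simp add: power2_eq_square algebra_simps)
    show ?thesis
      unfolding A_def using assms
      by (intro mult_mono le) (auto simp: power_le_one)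
  qed
  finally have "4 * ((norm (x - y))\<^sup>2 * (1 + r)) \<le> 4 * (r\<^sup>2 * ((1 - norm x) * (1 - norm y)))"
    using assms(3) by (simp add: mult_left_mono algebra_simps)
  then show ?thesis by simp
qed

section \<open>Comparison with twice the distance ratio metric\<close>

lemma hyp_dist_half_le_distance_ratio:
  assumes "x \<in> upper_half_space" "y \<in> upper_half_space" and "last_coord x \<le> last_coord y"
  shows "hyp_dist_half x y \<le> 2 * ln (1 + norm (x - y) / last_coord x)"
proof -
  define m where "m = last_coord x"
  define u where "u = norm (x - y) / m"
  have m: "m > 0" using assms by (simp add: m_def upper_half_space_def)
  have u: "u \<ge> 0" using m by (simp add: u_def)
  have "(norm (x - y))\<^sup>2 / (2 * last_coord x * last_coord y) \<le> (norm (x - y))\<^sup>2 / (2 * m * m)"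
    using assms m by (intro divide_left_mono) (auto simp: m_def)
  also have "\<dots> = 2 * (u / 2)\<^sup>2"
    by (simp add: u_def power2_eq_square)
  \<comment> \<open>The right side is cosh (2 s) - 1 with s = ln (1 + u), and sinh s = u (u + 2) /
    (2 (1 + u)) >= u / 2.\<close>
  also have "\<dots> \<le> 2 * (sinh (ln (1 + u)))\<^sup>2"
  proof -
    have "u / 2 \<le> sinh (ln (1 + u))"
      using u by (simp add: sinh_ln_real field_simps)
    then show ?thesis using u by (intro mult_left_mono power_mono) auto
  qed
  finally have "cosh (hyp_dist_half x y) \<le> cosh (2 * ln (1 + u))"
    using assms by (simp add: cosh_hyp_dist_half cosh_double cosh_square_eq)
  then show ?thesis
    using assms cosh_hyp_dist_half(2)[of x y] u cosh_real_nonneg_le_iff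
    by (simp add: u_def m_def)
qed

text \<open>By monotonicity of sinh the claim is t / sqrt A <= t (2 m + t) / (2 m (m + t)), which
  follows from 2 m (m + t) / (2 m + t) <= sqrt A. The left side of the latter increases with t, so
  it suffices to check the largest t allowed by |x - y| <= |x| + |y|.\<close>

lemma hyp_dist_ball_le_distance_ratio:
  assumes "norm x < 1" and "norm y \<le> norm x"
  shows "hyp_dist_ball x y \<le> 2 * ln (1 + norm (x - y) / (1 - norm x))"
proof -
  define m where "m = 1 - norm x"
  define d where "d = 1 - norm y"
  define t where "t = norm (x - y)"
  define A where "A = (1 - (norm x)\<^sup>2) * (1 - (norm y)\<^sup>2)"
  have bounds: "0 < m" "m \<le> d" "d \<le> 1" using assms by (auto simp: m_def d_def)
  have t: "0 \<le> t" "t \<le> 2 - m - d"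
    using norm_triangle_ineq4[of x y] by (auto simp: t_def m_def d_def)
  have A: "A = m * (2 - m) * (d * (2 - d))"
    by (simp add: A_def m_def d_def algebra_simps power2_eq_square)
  have A0: "A > 0" using bounds by (simp add: A)
  \<comment> \<open>The extremal case \<open>t = 2 - m - d\<close>, in which \<open>x\<close> and \<open>y\<close> lie on opposite radii.\<close>
  have "(2 * m * (2 - d))\<^sup>2 \<le> A * (2 + m - d)\<^sup>2"
  proof -
    \<comment> \<open>After the common factor m (2 - d) is split off, the difference of the two
      sides becomes a sum of products of nonnegative terms in e, m and 1 - d.\<close>
    define e where "e = d - m"
    have "0 \<le> (2 - m) * e * (4 * (1 - d) + m * e + e\<^sup>2) + 4 * m * e"
      using bounds by (auto simp: e_def intro!: add_nonneg_nonneg mult_nonneg_nonneg)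
    also have "\<dots> = (2 - m) * d * (2 + m - d)\<^sup>2 - 4 * m * (2 - d)"
      by (simp add: e_def power2_eq_square algebra_simps)
    finally have "0 \<le> (m * (2 - d)) * ((2 - m) * d * (2 + m - d)\<^sup>2 - 4 * m * (2 - d))"
      using bounds by (intro mult_nonneg_nonneg) auto
    also have "\<dots> = A * (2 + m - d)\<^sup>2 - (2 * m * (2 - d))\<^sup>2"
      by (simp add: A power2_eq_square algebra_simps)
    finally show ?thesis by simp
  qed
  then have "(2 * m * (2 - d))\<^sup>2 \<le> (sqrt A * (2 + m - d))\<^sup>2"
    using A0 by (simp add: power_mult_distrib)
  then have ext: "2 * m * (2 - d) \<le> sqrt A * (2 + m - d)"
    by (rule power2_le_imp_le) (use bounds A0 in auto)
  \<comment> \<open>Monotonicity in t: (m + t) / (2 m + t) = 1 - m / (2 m + t), and the right side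
    is the value at t = 2 - m - d.\<close>
  have "2 * m * (m + t) / (2 * m + t) \<le> 2 * m * (2 - d) / (2 + m - d)"
  proof -
    have "m * (m + t) \<le> m * (2 - d)" using bounds t by (intro mult_left_mono) auto
    then have "(m + t) * (2 + m - d) \<le> (2 - d) * (2 * m + t)"
      by (simp add: algebra_simps)
    then have "(m + t) / (2 * m + t) \<le> (2 - d) / (2 + m - d)"
      using bounds t by (simp add: pos_divide_le_eq pos_le_divide_eq)
    then have "2 * m * ((m + t) / (2 * m + t)) \<le> 2 * m * ((2 - d) / (2 + m - d))"
      using bounds by (intro mult_left_mono) auto
    then show ?thesis by simp
  qed
  also have "\<dots> \<le> sqrt A" using ext bounds by (simp add: pos_divide_le_eq)
  finally have "2 * m * (m + t) \<le> sqrt A * (2 * m + t)"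
    using bounds t by (simp add: pos_divide_le_eq)
  then have "t * (2 * m * (m + t)) \<le> t * (sqrt A * (2 * m + t))"
    using t by (intro mult_left_mono)
  then have "t / sqrt A \<le> t * (2 * m + t) / (2 * m * (m + t))"
    using bounds t A0 by (simp add: divide_simps mult_ac)
  also have "\<dots> = sinh (ln (1 + t / m))"
  proof -
    have "1 + t / m = (m + t) / m" using bounds by (simp add: field_simps)
    moreover have "(m + t) / m > 0" using bounds t by simp
    ultimately show ?thesis
      using bounds t by (simp add: sinh_ln_real divide_simps) (simp add: algebra_simps)
  qed
  finally have "sinh (hyp_dist_ball x y / 2) \<le> sinh (ln (1 + t / m))"
    by (simp add: sinh_hyp_dist_ball t_def A_def)
  then show ?thesis
    by (simp add: t_def m_def)
qed

section \<open>The inclusions between the balls\<close>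

lemma c_tilde_less_of_gap_bound:
  assumes "frontier D \<noteq> {}" and "0 < r"
    and "\<And>p. p \<in> frontier D \<Longrightarrow> a \<le> norm (x - p)" "\<And>p. p \<in> frontier D \<Longrightarrow> b \<le> norm (y - p)"
    and "0 \<le> a" "0 \<le> b" and "(norm (x - y))\<^sup>2 * (1 + r) \<le> r\<^sup>2 * (a * b)"
  shows "c_tilde D x y < r"
proof -
  have "c_tilde D x y \<le> r / sqrt (1 + r)"
    using assms
    by (intro c_tilde_le norm_diff_le_of_sq_less[of r _ a b]) (auto simp: le_max_iff_disj)
  \<comment> \<open>Strict bounds on the single quotients would only give <= r for the supremum; the
    uniform factor 1 / sqrt (1 + r) < 1 keeps the inequality strict.\<close>
  also have "\<dots> < r" using assms(2) by (simp add: field_simps)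
  finally show ?thesis .
qed

lemma c_tilde_less_of_hyp_dist_half_less:
  assumes "x \<in> upper_half_space" "y \<in> upper_half_space" and "0 < r"
    and "hyp_dist_half x y < ln (1 + r)"
  shows "c_tilde upper_half_space x y < r"
proof (rule c_tilde_less_of_gap_bound)
  show "frontier (upper_half_space :: (real ^ 'a::{finite,linorder}) set) \<noteq> {}"
    unfolding frontier_upper_half_space by (auto simp: last_coord_def intro: exI[of _ 0])
  show "(norm (x - y))\<^sup>2 * (1 + r) \<le> r\<^sup>2 * (last_coord x * last_coord y)"
    using assms by (rule hyp_dist_half_less_imp)
  show "last_coord z \<le> norm (z - p)" if "p \<in> frontier upper_half_space"
    for z p :: "real ^ 'a::{finite,linorder}"
    using that by (simp add: frontier_upper_half_space last_coord_le_norm_diff)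
  then show "last_coord y \<le> norm (y - p)" if "p \<in> frontier upper_half_space" for p
    using that .
qed (use assms in \<open>auto simp: upper_half_space_def\<close>)

lemma c_tilde_less_of_hyp_dist_ball_less:
  fixes x y :: "real ^ 'n"
  assumes "x \<in> ball 0 1" "y \<in> ball 0 1" and "0 < r" and "hyp_dist_ball x y < ln (1 + r)"
  shows "c_tilde (ball 0 1) x y < r"
proof (rule c_tilde_less_of_gap_bound)
  show "frontier (ball (0 :: real ^ 'n) 1) \<noteq> {}"
    by simp
  show "(norm (x - y))\<^sup>2 * (1 + r) \<le> r\<^sup>2 * ((1 - norm x) * (1 - norm y))"
    using assms by (intro hyp_dist_ball_less_imp) auto
  show "1 - norm z \<le> norm (z - p)" if "p \<in> frontier (ball 0 1)" for z p :: "real ^ 'n"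
    using that norm_triangle_ineq2[of p z] by (simp add: norm_minus_commute)
  then show "1 - norm y \<le> norm (y - p)" if "p \<in> frontier (ball 0 1)" for p
    using that .
qed (use assms in auto)

lemma hyp_dist_half_less_of_c_tilde_less:
  fixes x y :: "real ^ 'n::{finite,linorder}"
  assumes "x \<in> upper_half_space" "y \<in> upper_half_space" and "0 < r" "r < 1"
    and "c_tilde upper_half_space x y < r"
  shows "hyp_dist_half x y < 2 * ln (1 + r / (1 - r))"
proof -
  \<comment> \<open>Stated for fresh points so that symmetry can swap them: the point closer to the
    boundary must come first, since its height is the minimum in the distance ratio.\<close>
  have *: "hyp_dist_half x y < 2 * ln (1 + r / (1 - r))"
    if xy: "x \<in> upper_half_space" "y \<in> upper_half_space" "last_coord x \<le> last_coord y"
      and c: "c_tilde upper_half_space x y < r" for x y :: "real ^ 'n::{finite,linorder}"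
  proof -
    \<comment> \<open>The foot of the perpendicular from \<open>x\<close>, its nearest boundary
      point.\<close>
    define p where "p = x - last_coord x *\<^sub>R axis (Max UNIV) 1"
    have pos: "last_coord x > 0" using xy by (simp add: upper_half_space_def)
    have p: "p \<in> frontier upper_half_space"
      by (simp add: frontier_upper_half_space p_def last_coord_def)
    have n: "norm (x - p) = last_coord x"
      using pos by (simp add: p_def norm_axis_1)
    then have "norm (x - y) / last_coord x < r / (1 - r)"
      using norm_diff_less_of_c_tilde_less[OF p _ assms(3,4) c] pos by fastforce
    moreover have "0 \<le> norm (x - y) / last_coord x" using pos by simp
    ultimately have "ln (1 + norm (x - y) / last_coord x) < ln (1 + r / (1 - r))" by simp
    then show ?thesis
      using hyp_dist_half_le_distance_ratio[OF xy] by linarith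
  qed
  show ?thesis
  proof (cases "last_coord x \<le> last_coord y")
    case True
    then show ?thesis using * assms by blast
  next
    case False
    then show ?thesis
      using *[of y x] assms by (simp add: c_tilde_commute hyp_dist_half_commute)
  qed
qed

lemma hyp_dist_ball_less_of_c_tilde_less:
  fixes x y :: "real ^ 'n"
  assumes "x \<in> ball 0 1" "y \<in> ball 0 1" and "0 < r" "r < 1" and "c_tilde (ball 0 1) x y < r"
  shows "hyp_dist_ball x y < 2 * ln (1 + r / (1 - r))"
proof -
  have *: "hyp_dist_ball x y < 2 * ln (1 + r / (1 - r))"
    if xy: "norm x < 1" "norm y \<le> norm x" and c: "c_tilde (ball 0 1) x y < r" for x y :: "real ^ 'n"
  proof -
    \<comment> \<open>The radial projection of \<open>x\<close> to the sphere is a nearest boundary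
      point. For \<open>x = 0\<close> any unit vector serves, here an arbitrary coordinate
      axis.\<close>
    obtain e :: "real ^ 'n" where e: "norm e = 1" "x = norm x *\<^sub>R e"
    proof (cases "x = 0")
      case True
      then show ?thesis using that[of "axis undefined 1"] by (simp add: norm_axis_1)
    next
      case False
      then show ?thesis using that[of "x /\<^sub>R norm x"] by simp
    qed
    have p: "e \<in> frontier (ball 0 1)" using e by simp
    have "x - e = (norm x - 1) *\<^sub>R e"
      using e(2) by (metis scaleR_left_diff_distrib scaleR_one)
    then have n: "norm (x - e) = 1 - norm x" using e(1) xy by simp
    then have "norm (x - y) / (1 - norm x) < r / (1 - r)"
      using norm_diff_less_of_c_tilde_less[OF p _ assms(3,4) c] xy by fastforce
    moreover have "0 \<le> norm (x - y) / (1 - norm x)" using xy by simp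
    ultimately have "ln (1 + norm (x - y) / (1 - norm x)) < ln (1 + r / (1 - r))" by simp
    then show ?thesis
      using hyp_dist_ball_le_distance_ratio[OF xy] by linarith
  qed
  show ?thesis
  proof (cases "norm y \<le> norm x")
    case True
    then show ?thesis using * assms by simp
  next
    case False
    then show ?thesis
      using *[of y x] assms by (simp add: c_tilde_commute hyp_dist_ball_commute)
  qed
qed

theorem theorem5:
  fixes D :: "(real ^ 'n::{finite,linorder}) set"
    and \<rho> :: "real ^ 'n::{finite,linorder} \<Rightarrow> real ^ 'n::{finite,linorder} \<Rightarrow> real"
    and R1 R2 :: "real \<Rightarrow> real"
  assumes "(D = ball 0 1 \<and> \<rho> = hyp_dist_ball) \<or> (D = upper_half_space \<and> \<rho> = hyp_dist_half)"
    and "R1 = (\<lambda>r. ln (1 + r))"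
    and "R2 = (\<lambda>r. 2 * ln (1 + r / (1 - r)))"
  shows "(\<forall>x\<in>D. \<forall>r\<in>{0<..<1}.
            dist_ball D \<rho> x (R1 r) \<subseteq> dist_ball D (c_tilde D) x r \<and>
            dist_ball D (c_tilde D) x r \<subseteq> dist_ball D \<rho> x (R2 r)) \<and>
         ((\<lambda>r. R2 r / R1 r) \<longlongrightarrow> 2) (at_right 0)"
proof -
  \<comment> \<open>Near 0 the numerator is -2 ln (1 - r), asymptotic to 2 r, and the denominator is
    asymptotic to r.\<close>
  have "((\<lambda>r. R2 r / R1 r) \<longlongrightarrow> 2) (at_right 0)"
    unfolding assms(2,3) by real_asymp
  moreover have "dist_ball D \<rho> x (R1 r) \<subseteq> dist_ball D (c_tilde D) x r \<and>
      dist_ball D (c_tilde D) x r \<subseteq> dist_ball D \<rho> x (R2 r)"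
    if "x \<in> D" "r \<in> {0<..<1}" for x r
    using assms(1)
  proof
    assume "D = ball 0 1 \<and> \<rho> = hyp_dist_ball"
    then show ?thesis
      using that c_tilde_less_of_hyp_dist_ball_less[of x _ r]
        hyp_dist_ball_less_of_c_tilde_less[of x _ r]
      unfolding assms(2,3) dist_ball_def by auto
  next
    assume "D = upper_half_space \<and> \<rho> = hyp_dist_half"
    then show ?thesis
      using that c_tilde_less_of_hyp_dist_half_less[of x _ r]
        hyp_dist_half_less_of_c_tilde_less[of x _ r]
      unfolding assms(2,3) dist_ball_def by auto
  qed
  ultimately show ?thesis by blast
qed

end
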